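(* Let $a<b$ be real numbers and let $r,s$ be positive continuous functions on the interval $(a,b)$. Put $R(x,b)=\int_x^b r(t)\,dt$. Then for all measurable functions $f\ge 0$ on $(a,b)$ such that all integrals below exist and are finite, $$\left(\int_a^b r(x)\left(\int_a^x f(t)\,dt\right)dx\right)^2\le \left(\int_a^b \frac{R^2(x,b)}{s(x)}\,dx\right)\left(\int_a^b s(x)\,(f(x))^2\,dx\right).$$
   Context: Standing assumption: all functions are measurable and all the integrals appearing in the inequality (including the integrals defining $R(x,b)$ for $x\in(a,b)$ and $\int_a^x f$) exist and are finite. $R^2(x,b)$ means $(R(x,b))^2$. *)

theory Defs
  imports "HOL-Analysis.Analysis"
begin

text \<open>\<open>R(x,b)\<close> as a Lebesgue integral over the open interval, since \<open>r\<close> is only controlled on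
  \<open>(a,b)\<close> and its value at the endpoint \<open>b\<close> is irrelevant.\<close>

definition R :: "(real \<Rightarrow> real) \<Rightarrow> real \<Rightarrow> real \<Rightarrow> real" where
  "R r x b = (LINT t:{x<..<b}|lebesgue. r t)"

end

theory Submission
  imports Defs
begin

text \<open>Exchanging the order of integration turns the left-hand integral into
  \<open>\<integral> f(t) R(t,b) dt\<close>; then Cauchy-Schwarz is applied to \<open>R(\<cdot>,b) / \<surd>s\<close> and \<open>\<surd>s f\<close>.\<close>

text \<open>The integral of \<open>(u x - t * v x)\<^sup>2\<close> is nonnegative for every real
  \<open>t\<close>, so a polynomial in \<open>t\<close> of degree at most two is nonnegative
  everywhere; testing it at one well-chosen \<open>t\<close> gives the bound.\<close>

lemma Cauchy_Schwarz_integral: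
  fixes u v :: "'a \<Rightarrow> real"
  assumes "integrable M (\<lambda>x. (u x)\<^sup>2)" "integrable M (\<lambda>x. (v x)\<^sup>2)" "integrable M (\<lambda>x. u x * v x)"
  shows "(LINT x|M. u x * v x)\<^sup>2 \<le> (LINT x|M. (u x)\<^sup>2) * (LINT x|M. (v x)\<^sup>2)"
proof -
  define A B C where "A = (LINT x|M. (u x)\<^sup>2)" and "B = (LINT x|M. (v x)\<^sup>2)"
    and "C = (LINT x|M. u x * v x)"
  have quad: "0 \<le> A - 2 * t * C + t\<^sup>2 * B" for t
  proof -
    have "0 \<le> (LINT x|M. (u x - t * v x)\<^sup>2)"
      by simp
    also have "\<dots> = (LINT x|M. (u x)\<^sup>2 - 2 * t * (u x * v x) + t\<^sup>2 * (v x)\<^sup>2)"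
      by (simp add: power2_diff algebra_simps)
    also have "\<dots> = A - 2 * t * C + t\<^sup>2 * B"
      using assms by (simp add: A_def B_def C_def)
    finally show ?thesis .
  qed
  have "B \<ge> 0"
    by (simp add: B_def)
  have "C\<^sup>2 \<le> A * B"
  proof (cases "B = 0")
    case True
    \<comment> \<open>With \<open>B = 0\<close> the polynomial is affine in \<open>t\<close>. If
      \<open>C\<close> were nonzero, the chosen \<open>t\<close> would make it
      \<open>A - (A + 1) = -1\<close>.\<close>
    then have "C = 0"
      using quad[of "(A + 1) / (2 * C)"] by (cases "C = 0") (simp_all add: field_simps)
    then show ?thesis
      using True by simp
  next
    case False
    \<comment> \<open>\<open>C / B\<close> is the minimiser of the quadratic, where its value is
      \<open>A - C\<^sup>2 / B\<close>.\<close>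
    then show ?thesis
      using quad[of "C / B"] \<open>B \<ge> 0\<close> by (simp add: field_simps power2_eq_square)
  qed
  then show ?thesis
    by (simp add: A_def B_def C_def)
qed

text \<open>Completion keeps the Borel sets and their measures, so a countable cover by sets of
  finite \<open>lborel\<close> measure serves unchanged. This makes Tonelli available for
  \<open>lebesgue\<close> itself.\<close>

lemma sigma_finite_lebesgue: "sigma_finite_measure (lebesgue :: 'a::euclidean_space measure)"
proof -
  obtain A :: "'a set set" where "countable A" "A \<subseteq> sets lborel" "\<Union>A = space lborel"
    "\<forall>a\<in>A. emeasure lborel a \<noteq> \<infinity>"
    using lborel.sigma_finite_countable by blast
  then show ?thesis
    by (intro sigma_finite_measure.intro exI[of _ A]) (auto simp: subset_iff)
qed

text \<open>Tonelli on the triangle t < x: both sides integrate \<open>F x * G t\<close> over it. In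
  \<open>ennreal\<close> this asks only for measurability, and bounded ranges can be encoded by
  letting \<open>F\<close> and \<open>G\<close> vanish outside them.\<close>

lemma nn_integral_triangle_swap:
  fixes F G :: "real \<Rightarrow> ennreal"
  assumes [measurable]: "F \<in> borel_measurable lebesgue" "G \<in> borel_measurable lebesgue"
  shows "(\<integral>\<^sup>+x. F x * (\<integral>\<^sup>+t\<in>{..<x}. G t \<partial>lebesgue) \<partial>lebesgue)
    = (\<integral>\<^sup>+t. G t * (\<integral>\<^sup>+x\<in>{t<..}. F x \<partial>lebesgue) \<partial>lebesgue)"
proof -
  interpret pair_sigma_finite "lebesgue :: real measure" "lebesgue :: real measure"
    by (intro pair_sigma_finite.intro sigma_finite_lebesgue)
  \<comment> \<open>The projections of the product map into \<open>lebesgue\<close>; composing them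
    with the identity from \<open>lebesgue\<close> to the Borel sets makes them Borel functions,
    hence the triangle \<open>snd p < fst p\<close> measurable in the product.\<close>
  have id: "(\<lambda>x. x) \<in> borel_measurable (lebesgue :: real measure)"
    by (rule measurable_completion) simp
  have fs [measurable]: "fst \<in> borel_measurable (lebesgue \<Otimes>\<^sub>M (lebesgue :: real measure) :: (real \<times> real) measure)"
    "snd \<in> borel_measurable ((lebesgue :: real measure) \<Otimes>\<^sub>M lebesgue :: (real \<times> real) measure)"
    using measurable_compose[OF measurable_fst id] measurable_compose[OF measurable_snd id] by auto
  have m: "(\<lambda>(x, t). F x * (G t * indicator {p. snd p < fst p} (x, t)))
      \<in> borel_measurable (lebesgue \<Otimes>\<^sub>M (lebesgue :: real measure))"
  proof -
    have [measurable]: "{p \<in> space (lebesgue \<Otimes>\<^sub>M lebesgue). snd p < (fst p :: real)} \<in> sets (lebesgue \<Otimes>\<^sub>M lebesgue)"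
      by measurable
    then have [measurable]: "{p. snd p < (fst p :: real)} \<in> sets (lebesgue \<Otimes>\<^sub>M lebesgue)"
      by (simp add: space_pair_measure)
    show ?thesis
      by measurable
  qed
  have [measurable]: "{..<x} \<in> sets lebesgue" "{x<..} \<in> sets lebesgue" for x :: real
    by auto
  have "(\<integral>\<^sup>+x. F x * (\<integral>\<^sup>+t\<in>{..<x}. G t \<partial>lebesgue) \<partial>lebesgue)
      = (\<integral>\<^sup>+x. \<integral>\<^sup>+t. F x * (G t * indicator {..<x} t) \<partial>lebesgue \<partial>lebesgue)"
    by (intro nn_integral_cong nn_integral_cmult[symmetric]) measurable
  also have "\<dots> = (\<integral>\<^sup>+x. \<integral>\<^sup>+t. F x * (G t * indicator {p. snd p < fst p} (x, t)) \<partial>lebesgue \<partial>lebesgue)"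
    by (intro nn_integral_cong) (simp add: indicator_def)
  also have "\<dots> = (\<integral>\<^sup>+t. \<integral>\<^sup>+x. F x * (G t * indicator {p. snd p < fst p} (x, t)) \<partial>lebesgue \<partial>lebesgue)"
    by (rule Fubini'[OF m, symmetric])
  also have "\<dots> = (\<integral>\<^sup>+t. \<integral>\<^sup>+x. G t * (F x * indicator {t<..} x) \<partial>lebesgue \<partial>lebesgue)"
    by (intro nn_integral_cong) (simp add: indicator_def mult.commute)
  also have "\<dots> = (\<integral>\<^sup>+t. G t * (\<integral>\<^sup>+x\<in>{t<..}. F x \<partial>lebesgue) \<partial>lebesgue)"
    by (intro nn_integral_cong nn_integral_cmult) measurable
  finally show ?thesis .
qed

lemma set_integral_nonneg:
  fixes h :: "'a \<Rightarrow> real"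
  assumes "\<And>x. x \<in> A \<Longrightarrow> 0 \<le> h x"
  shows "0 \<le> (LINT x:A|M. h x)"
  unfolding set_lebesgue_integral_def using assms
  by (intro Bochner_Integration.integral_nonneg) (simp add: indicator_def)

text \<open>The bridge between the real-valued set integrals of the theorem and the
  \<open>ennreal\<close> integrals in which the order is exchanged.\<close>

lemma nn_integral_eq_set_integral:
  fixes h :: "'a \<Rightarrow> real"
  assumes "set_integrable M A h" "\<And>x. x \<in> A \<Longrightarrow> 0 \<le> h x"
  shows "(\<integral>\<^sup>+x\<in>A. ennreal (h x) \<partial>M) = ennreal (LINT x:A|M. h x)"
  unfolding nn_integral_set_ennreal set_lebesgue_integral_def
  using assms by (subst nn_integral_eq_integral[symmetric])
    (auto simp: set_integrable_def indicator_def mult_ac intro!: nn_integral_cong)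

theorem theorem2p1:
  fixes a b :: real and r s f :: "real \<Rightarrow> real"
  assumes "a < b"
    and "continuous_on {a<..<b} r" and "\<And>x. x \<in> {a<..<b} \<Longrightarrow> r x > 0"
    and "continuous_on {a<..<b} s" and "\<And>x. x \<in> {a<..<b} \<Longrightarrow> s x > 0"
    and "f \<in> borel_measurable (lebesgue_on {a<..<b})" and "\<And>x. x \<in> {a<..<b} \<Longrightarrow> f x \<ge> 0"
    and "\<And>x. x \<in> {a<..<b} \<Longrightarrow> set_integrable lebesgue {x<..<b} r"
    and "\<And>x. x \<in> {a<..<b} \<Longrightarrow> set_integrable lebesgue {a<..<x} f"
    and "set_integrable lebesgue {a<..<b} (\<lambda>x. r x * (LINT t:{a<..<x}|lebesgue. f t))"
    and "set_integrable lebesgue {a<..<b} (\<lambda>x. (R r x b)\<^sup>2 / s x)"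
    and "set_integrable lebesgue {a<..<b} (\<lambda>x. s x * (f x)\<^sup>2)"
  shows "(LINT x:{a<..<b}|lebesgue. r x * (LINT t:{a<..<x}|lebesgue. f t))\<^sup>2
    \<le> (LINT x:{a<..<b}|lebesgue. (R r x b)\<^sup>2 / s x) * (LINT x:{a<..<b}|lebesgue. s x * (f x)\<^sup>2)"
proof -
  define I where "I = {a<..<b}"
  \<comment> \<open>The indicators extend everything by zero to the whole line, since signs and
    regularity are known only on \<open>I\<close>. The factor \<open>sqrt (s x)\<close> is placed so
    that it cancels in \<open>u x * v x\<close>, while the squares of \<open>u\<close> and
    \<open>v\<close> are the two integrands on the right.\<close>
  define F where "F x = ennreal (r x) * indicator I x" for x
  define G where "G x = ennreal (f x) * indicator I x" for x
  define u where "u x = indicator I x * (R r x b / sqrt (s x))" for x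
  define v where "v x = indicator I x * (sqrt (s x) * f x)" for x
  have I [measurable]: "I \<in> sets lebesgue"
    by (simp add: I_def)
  have s: "s x > 0" and r: "r x > 0" and f: "f x \<ge> 0" if "x \<in> I" for x
    using that assms by (auto simp: I_def)
  have f0: "0 \<le> (LINT t:{a<..<x}|lebesgue. f t)" if "x \<in> I" for x
    using that f by (intro set_integral_nonneg) (auto simp: I_def)
  have R0: "0 \<le> R r x b" if "x \<in> I" for x
    unfolding R_def using that r by (intro set_integral_nonneg less_imp_le) (auto simp: I_def)
  have mr: "r \<in> borel_measurable (lebesgue_on I)"
    unfolding I_def by (intro continuous_imp_measurable_on_sets_lebesgue assms) auto
  have mf: "f \<in> borel_measurable (lebesgue_on I)"
    using assms by (simp add: I_def)
  have [measurable]: "F \<in> borel_measurable lebesgue" "G \<in> borel_measurable lebesgue"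
    using measurable_compose[OF mr measurable_ennreal] measurable_compose[OF mf measurable_ennreal]
    by (simp_all add: F_def[abs_def] G_def[abs_def] borel_measurable_restrict_space_iff_ennreal)
  have GI: "(\<integral>\<^sup>+t\<in>{..<x}. G t \<partial>lebesgue) = ennreal (LINT t:{a<..<x}|lebesgue. f t)" if "x \<in> I" for x
  proof -
    have "(\<integral>\<^sup>+t\<in>{..<x}. G t \<partial>lebesgue) = (\<integral>\<^sup>+t\<in>{a<..<x}. ennreal (f t) \<partial>lebesgue)"
      using that by (intro nn_integral_cong) (auto simp: G_def I_def indicator_def)
    also have "\<dots> = ennreal (LINT t:{a<..<x}|lebesgue. f t)"
      using that assms(9) f by (intro nn_integral_eq_set_integral) (auto simp: I_def)
    finally show ?thesis .
  qed
  have FI: "(\<integral>\<^sup>+x\<in>{t<..}. F x \<partial>lebesgue) = ennreal (R r t b)" if "t \<in> I" for t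
  proof -
    have "(\<integral>\<^sup>+x\<in>{t<..}. F x \<partial>lebesgue) = (\<integral>\<^sup>+x\<in>{t<..<b}. ennreal (r x) \<partial>lebesgue)"
      using that by (intro nn_integral_cong) (auto simp: F_def I_def indicator_def)
    also have "\<dots> = ennreal (R r t b)"
      unfolding R_def using that assms(8) r
      by (intro nn_integral_eq_set_integral) (auto simp: I_def less_imp_le)
    finally show ?thesis .
  qed
  let ?L = "LINT x:I|lebesgue. r x * (LINT t:{a<..<x}|lebesgue. f t)"
  have L0: "0 \<le> ?L"
    using f0 r by (intro set_integral_nonneg) (simp add: less_imp_le)
  have uv0: "0 \<le> u x * v x" for x
    using s f R0 by (simp add: u_def v_def indicator_def less_imp_le)
  have u2: "(u x)\<^sup>2 = indicator I x *\<^sub>R ((R r x b)\<^sup>2 / s x)" for x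
    using s[of x] by (simp add: u_def indicator_def power_divide less_imp_le)
  have v2: "(v x)\<^sup>2 = indicator I x *\<^sub>R (s x * (f x)\<^sup>2)" for x
    using s[of x] by (simp add: v_def indicator_def power_mult_distrib less_imp_le)
  have u2_int: "integrable lebesgue (\<lambda>x. (u x)\<^sup>2)" and v2_int: "integrable lebesgue (\<lambda>x. (v x)\<^sup>2)"
    using assms(11,12) by (simp_all add: u2 v2 set_integrable_def I_def)
  \<comment> \<open>As \<open>u\<close> and \<open>v\<close> are nonnegative, they are the square
    roots of their integrable squares. Their measurability follows from this, without studying
    \<open>R r x b\<close> as a function of \<open>x\<close>.\<close>
  have "(\<lambda>x. sqrt ((u x)\<^sup>2)) = u" "(\<lambda>x. sqrt ((v x)\<^sup>2)) = v"
    using s f R0 by (auto simp: u_def v_def indicator_def less_imp_le)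
  then have mu: "u \<in> borel_measurable lebesgue" and mv: "v \<in> borel_measurable lebesgue"
    using measurable_compose[OF borel_measurable_integrable[OF u2_int] borel_measurable_sqrt]
      measurable_compose[OF borel_measurable_integrable[OF v2_int] borel_measurable_sqrt] by (simp_all only:)
  have "ennreal ?L = (\<integral>\<^sup>+x\<in>I. ennreal (r x * (LINT t:{a<..<x}|lebesgue. f t)) \<partial>lebesgue)"
    using assms(10) f0 r by (intro nn_integral_eq_set_integral[symmetric]) (auto simp: I_def less_imp_le)
  also have "\<dots> = (\<integral>\<^sup>+x. F x * (\<integral>\<^sup>+t\<in>{..<x}. G t \<partial>lebesgue) \<partial>lebesgue)"
    using GI f0 r by (intro nn_integral_cong) (auto simp: F_def indicator_def ennreal_mult less_imp_le)
  also have "\<dots> = (\<integral>\<^sup>+t. G t * (\<integral>\<^sup>+x\<in>{t<..}. F x \<partial>lebesgue) \<partial>lebesgue)"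
    by (rule nn_integral_triangle_swap) measurable
  also have "\<dots> = (\<integral>\<^sup>+x. ennreal (u x * v x) \<partial>lebesgue)"
  proof (intro nn_integral_cong)
    fix t
    show "G t * (\<integral>\<^sup>+x\<in>{t<..}. F x \<partial>lebesgue) = ennreal (u t * v t)"
    proof (cases "t \<in> I")
      case True
      \<comment> \<open>Positivity of \<open>s t\<close> lets the two square roots cancel; outside
        \<open>I\<close> both sides vanish.\<close>
      then have "u t * v t = f t * R r t b"
        using s[OF True] by (simp add: u_def v_def)
      then show ?thesis
        using True FI f R0 by (simp add: G_def ennreal_mult)
    qed (simp add: G_def u_def)
  qed
  finally have uv: "(\<integral>\<^sup>+x. ennreal (u x * v x) \<partial>lebesgue) = ennreal ?L" ..
  \<comment> \<open>Integrability of the product comes from the exchange of integrals: its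
    nonnegative integral equals \<open>ennreal ?L\<close>, which is finite.\<close>
  have uv_int: "integrable lebesgue (\<lambda>x. u x * v x)"
    using mu mv uv0 by (intro integrableI_nn_integral_finite[OF _ _ uv]) auto
  \<comment> \<open>\<open>ennreal\<close> sends negative reals to 0, so passing back to an equality
    of reals relies on both sides being nonnegative.\<close>
  have uv_eq: "(LINT x|lebesgue. u x * v x) = ?L"
    using uv nn_integral_eq_integral[OF uv_int] uv0 L0 by (simp add: integral_nonneg_AE)
  have "(LINT x|lebesgue. u x * v x)\<^sup>2 \<le> (LINT x|lebesgue. (u x)\<^sup>2) * (LINT x|lebesgue. (v x)\<^sup>2)"
    using u2_int v2_int uv_int by (rule Cauchy_Schwarz_integral)
  then show ?thesis
    by (simp add: uv_eq u2 v2 set_lebesgue_integral_def I_def)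
qed

end
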